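(* Let $N\ge1$ be an integer and let $0<c\le1/2^{2N-1}$. Then $(X_t^\varepsilon)_{t\ge0}\longrightarrow(X_t)_{t\ge0}$ as $\varepsilon\to0^+$, i.e. for every $n\ge1$, all $t_1,\dots,t_n\ge0$ and all $\mu_1,\dots,\mu_n\in\mathbb{R}$, $$\lim_{\varepsilon\to0^+}\mathbb{E}\!\left(\mathrm{e}^{\mathrm{i}\sum_{k=1}^n\mu_kX_{t_k}^\varepsilon}\right)=\mathbb{E}\!\left(\mathrm{e}^{\mathrm{i}\sum_{k=1}^n\mu_kX_{t_k}}\right).$$
   Context: Pseudo-random walk: put $p_k=\delta_{k0}+(-1)^{k-1}c\binom{2N}{k+N}$ for $k\in\{-N,\dots,N\}$ (real numbers, possibly negative, summing to $1$). The $U_n$, $n\ge1$, are i.i.d. pseudo-random variables with $\mathbb{P}\{U_1=k_1,\dots,U_n=k_n\}=p_{k_1}\cdots p_{k_n}$ (a signed measure of total mass one), pseudo-expectations being the corresponding finite weighted sums; $S_0=0$, $S_n=U_1+\dots+U_n$. For $\varepsilon>0$, $X_t^\varepsilon=\varepsilon S_{\lfloor t/\varepsilon^{2N}\rfloor}$, $t\ge0$. $(X_t)_{t\ge0}$ is the pseudo-Brownian motion, i.e. the pseudo-process (driven by a signed measure) with $X_0=0$ whose finite-dimensional pseudo-distributions are characterized by: for $0=t_0\le t_1<\dots<t_n$ and $\mu_1,\dots,\mu_n\in\mathbb{R}$, $$\mathbb{E}\!\left(\mathrm{e}^{\mathrm{i}\sum_{k=1}^n\mu_kX_{t_k}}\right)=\mathrm{e}^{-c\sum_{k=1}^n(\mu_k+\dots+\mu_n)^{2N}(t_k-t_{k-1})}$$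 (for unordered or repeated times, reorder them and add the coefficients of equal times). *)

theory Defs
  imports "HOL-Probability.Probability"
begin

subsection \<open>The pseudo-random walk\<close>

definition step_weight :: "nat \<Rightarrow> real \<Rightarrow> int \<Rightarrow> real" where
  "step_weight N c k =
     (if k = 0 then 1 else 0) + (-1) powi (k - 1) * c * real ((2 * N) choose nat (k + int N))"

text \<open>
  A sequence \<open>u :: nat \<Rightarrow> int\<close> stands for the values of \<open>U\<^sub>1, U\<^sub>2, \<dots>\<close>; \<open>u 0\<close> is unused.
  The pseudo-expectation of a function of \<open>U\<^sub>1, \<dots>, U\<^sub>m\<close> is a sum weighted by the signed
  product law on \<open>{-N..N}\<^sup>m\<close>.
\<close>

definition depends_on_first :: "nat \<Rightarrow> ((nat \<Rightarrow> int) \<Rightarrow> 'a) \<Rightarrow> bool" where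
  "depends_on_first m F \<longleftrightarrow> (\<forall>u v. (\<forall>j\<in>{1..m}. u j = v j) \<longrightarrow> F u = F v)"

definition expectation_upto :: "nat \<Rightarrow> real \<Rightarrow> nat \<Rightarrow> ((nat \<Rightarrow> int) \<Rightarrow> complex) \<Rightarrow> complex" where
  "expectation_upto N c m F =
     (\<Sum>u \<in> {1..m} \<rightarrow>\<^sub>E {- int N..int N}. of_real (\<Prod>j\<in>{1..m}. step_weight N c (u j)) * F u)"

text \<open>
  The pseudo-expectation of a function of finitely many steps. The choice of the least \<open>m\<close>
  is immaterial, by \<open>walk_expectation_eq\<close> below; the value is junk if \<open>F\<close> depends on
  infinitely many steps.
\<close>

definition walk_expectation :: "nat \<Rightarrow> real \<Rightarrow> ((nat \<Rightarrow> int) \<Rightarrow> complex) \<Rightarrow> complex" where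
  "walk_expectation N c F = expectation_upto N c (LEAST m. depends_on_first m F) F"

definition walk :: "nat \<Rightarrow> (nat \<Rightarrow> int) \<Rightarrow> int" where
  "walk m u = (\<Sum>j=1..m. u j)"

definition scaled_walk :: "nat \<Rightarrow> real \<Rightarrow> real \<Rightarrow> (nat \<Rightarrow> int) \<Rightarrow> real" where
  "scaled_walk N \<epsilon> t u = \<epsilon> * of_int (walk (nat \<lfloor>t / \<epsilon> ^ (2 * N)\<rfloor>) u)"

lemma sum_step_weight:
  assumes "N \<ge> 1"
  shows "(\<Sum>k\<in>{- int N..int N}. step_weight N c k) = 1"
proof -
  have "(\<Sum>k\<in>{- int N..int N}. (-1) powi (k - 1) * c * real ((2 * N) choose nat (k + int N)))
      = (\<Sum>i\<le>2 * N. (-1) powi (int i - int N - 1) * c * real ((2 * N) choose i))"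
    by (rule sum.reindex_bij_witness[of _ "\<lambda>i. int i - int N" "\<lambda>k. nat (k + int N)"]) auto
  also have "\<dots> = (\<Sum>i\<le>2 * N. ((-1) powi (- int N - 1) * c) * ((-1) ^ i * real ((2 * N) choose i)))"
  proof (rule sum.cong)
    fix i
    have "(-1 :: real) powi (int i - int N - 1) = (-1) powi (int i + (- int N - 1))"
      by (simp add: algebra_simps)
    also have "\<dots> = (-1) ^ i * (-1) powi (- int N - 1)"
      by (subst power_int_add) auto
    finally show "(-1) powi (int i - int N - 1) * c * real ((2 * N) choose i)
        = ((-1) powi (- int N - 1) * c) * ((-1) ^ i * real ((2 * N) choose i))"
      by simp
  qed simp
  also have "\<dots> = 0"
    using choose_alternating_sum[of "2 * N", where ?'a = real] assms
    by (simp add: sum_distrib_left[symmetric])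
  finally show ?thesis
    by (simp add: step_weight_def sum.distrib)
qed

lemma expectation_upto_Suc:
  assumes "N \<ge> 1" and F: "depends_on_first m F"
  shows "expectation_upto N c (Suc m) F = expectation_upto N c m F"
proof -
  let ?K = "{- int N..int N}" and ?p = "step_weight N c"
  have ins: "{1..Suc m} = insert (Suc m) {1..m}" by auto
  have inj: "inj_on (\<lambda>(y, g). g(Suc m := y)) (?K \<times> ({1..m} \<rightarrow>\<^sub>E ?K))"
    by (rule inj_combinator) simp
  have prod: "(\<Prod>j\<in>{1..Suc m}. ?p ((g(Suc m := y)) j)) = ?p y * (\<Prod>j\<in>{1..m}. ?p (g j))" for g y
    by (simp add: ins)
  have FF: "F (g(Suc m := y)) = F g" for g y
    using F by (auto simp: depends_on_first_def)
  have "expectation_upto N c (Suc m) F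
      = (\<Sum>(y, g) \<in> ?K \<times> ({1..m} \<rightarrow>\<^sub>E ?K). of_real (?p y) * (of_real (\<Prod>j\<in>{1..m}. ?p (g j)) * F g))"
    unfolding expectation_upto_def ins PiE_insert_eq
    by (subst sum.reindex[OF inj])
      (simp only: ins[symmetric] comp_def case_prod_unfold prod FF of_real_mult mult.assoc)
  also have "\<dots> = of_real (\<Sum>y\<in>?K. ?p y) * expectation_upto N c m F"
    by (simp add: expectation_upto_def sum_product sum.cartesian_product)
  finally show ?thesis
    using sum_step_weight[OF assms(1)] by simp
qed

lemma walk_expectation_eq:
  assumes "N \<ge> 1" and F: "depends_on_first m F"
  shows "walk_expectation N c F = expectation_upto N c m F"
proof -
  let ?l = "LEAST m. depends_on_first m F"
  have l: "depends_on_first ?l F" using F by (rule LeastI)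
  have "?l \<le> m" using F by (rule Least_le)
  then have "expectation_upto N c m F = expectation_upto N c ?l F"
  proof (induction m rule: dec_induct)
    case (step k)
    have "depends_on_first k F"
      using l step.hyps unfolding depends_on_first_def by (meson atLeastAtMost_iff le_trans)
    with step.IH show ?case using expectation_upto_Suc[OF assms(1)] by simp
  qed simp
  then show ?thesis by (simp add: walk_expectation_def)
qed

subsection \<open>Pseudo-processes\<close>

text \<open>
  A finite signed measure is represented by a pair \<open>(P, Q)\<close> of finite measures, standing for
  \<open>P - Q\<close>; by the Jordan decomposition every finite signed measure is of this form.
  The pair need not be mutually singular.
\<close>

type_synonym 'a signed_measure = "'a measure \<times> 'a measure"

definition signed_measure_on :: "'a measure \<Rightarrow> 'a signed_measure \<Rightarrow> bool" where
  "signed_measure_on M S \<longleftrightarrow>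
     finite_measure (fst S) \<and> finite_measure (snd S) \<and>
     sets (fst S) = sets M \<and> sets (snd S) = sets M"

definition signed_value :: "'a signed_measure \<Rightarrow> 'a set \<Rightarrow> real" where
  "signed_value S A = measure (fst S) A - measure (snd S) A"

definition signed_integral :: "'a signed_measure \<Rightarrow> ('a \<Rightarrow> complex) \<Rightarrow> complex" where
  "signed_integral S f = (\<integral>x. f x \<partial>fst S) - (\<integral>x. f x \<partial>snd S)"

text \<open>
  A real pseudo-process indexed by \<open>[0, \<infinity>)\<close> is given by its finite-dimensional
  pseudo-distributions: \<open>X J\<close> is the signed law of \<open>(X\<^sub>t)\<close> for \<open>t \<in> J\<close>, on the product space
  indexed by the set of times \<open>J\<close> itself. There is in general no signed measure of finite total
  variation on the path space.
\<close>

definition pseudo_process :: "(real set \<Rightarrow> (real \<Rightarrow> real) signed_measure) \<Rightarrow> bool" where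
  "pseudo_process X \<longleftrightarrow>
     (\<forall>J. finite J \<and> J \<subseteq> {0..} \<longrightarrow>
        signed_measure_on (Pi\<^sub>M J (\<lambda>_. borel)) (X J) \<and>
        signed_value (X J) (space (Pi\<^sub>M J (\<lambda>_. borel))) = 1) \<and>
     (\<forall>I J A. finite J \<and> J \<subseteq> {0..} \<and> I \<subseteq> J \<and> A \<in> sets (Pi\<^sub>M I (\<lambda>_. borel)) \<longrightarrow>
        signed_value (X I) A = signed_value (X J) (prod_emb J (\<lambda>_. borel) I A))"

text \<open>
  Only strictly increasing times are prescribed. For unordered or repeated times,
  \<open>X (t ` {1..n})\<close> lives on the set of times, so that reordering the times and adding the
  coefficients of equal times does not change the integrand.
\<close>

definition pseudo_brownian_motion ::
    "nat \<Rightarrow> real \<Rightarrow> (real set \<Rightarrow> (real \<Rightarrow> real) signed_measure) \<Rightarrow> bool" where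
  "pseudo_brownian_motion N c X \<longleftrightarrow>
     pseudo_process X \<and>
     (\<forall>A \<in> sets (Pi\<^sub>M {0} (\<lambda>_. borel)). signed_value (X {0}) A = indicator A (restrict (\<lambda>_. 0) {0})) \<and>
     (\<forall>n t \<mu>. n \<ge> 1 \<and> t 0 = 0 \<and> t 0 \<le> t 1 \<and> (\<forall>k\<in>{1..<n}. t k < t (Suc k)) \<longrightarrow>
        signed_integral (X (t ` {1..n})) (\<lambda>x. exp (\<i> * of_real (\<Sum>k=1..n. \<mu> k * x (t k))))
        = of_real (exp (- c * (\<Sum>k=1..n. (\<Sum>j=k..n. \<mu> j) ^ (2 * N) * (t k - t (k - 1))))))"

end

theory Submission imports Defs begin

text \<open>
  The steps are independent, so pseudo-expectations of exponentials of linear combinations of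
  steps factor. A single step has the real characteristic function
  \<open>\<phi>(\<theta>) = 1 - c (2 sin (\<theta>/2))\<^bsup>2N\<^esup>\<close>, by the binomial theorem for \<open>(1 - e\<^bsup>i\<theta>\<^esup>)\<^bsup>2N\<^esup>\<close>
  (\<open>step_characteristic_function\<close>).

  Let the times be \<open>0 = s\<^sub>0 \<le> s\<^sub>1 < \<dots> < s\<^sub>r\<close>, with coefficients \<open>\<nu>\<^sub>1, \<dots>, \<nu>\<^sub>r\<close>, and put
  \<open>m\<^sub>l = \<lfloor>s\<^sub>l / \<epsilon>\<^bsup>2N\<^esup>\<rfloor>\<close>. A step with index in \<open>{m\<^bsub>l-1\<^esub><..m\<^sub>l}\<close> contributes to exactly the positions at
  \<open>s\<^sub>l, \<dots>, s\<^sub>r\<close>, so it carries the coefficient \<open>\<epsilon> b\<^sub>l\<close> with \<open>b\<^sub>l = \<nu>\<^sub>l + \<dots> + \<nu>\<^sub>r\<close>, and the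
  pseudo-expectation is the product of the powers \<open>\<phi>(\<epsilon> b\<^sub>l)\<close> to the \<open>m\<^sub>l - m\<^bsub>l-1\<^esub>\<close>
  (\<open>walk_expectation_ordered\<close>). The exponent is about \<open>(s\<^sub>l - s\<^bsub>l-1\<^esub>) / \<epsilon>\<^bsup>2N\<^esup>\<close>
  and \<open>\<phi>(\<epsilon> b) - 1\<close> is about \<open>- c b\<^bsup>2N\<^esup> \<epsilon>\<^bsup>2N\<^esup>\<close>, so each power converges, in the
  manner of \<open>(1 + x/n)\<^sup>n\<close>, to the corresponding exponential factor of pseudo-Brownian motion
  (\<open>block_power_tendsto\<close>).

  Arbitrary times reduce to this case because both integrands depend on the times only through
  \<open>\<Sum>k. \<mu>\<^sub>k f(t\<^sub>k)\<close>, which can be rewritten as a sum over the increasing enumeration of the set of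
  times, the coefficients of equal times being added (\<open>ordered_times\<close>, \<open>sum_group_times\<close>).
\<close>

section \<open>The pseudo-characteristic function of the walk\<close>

definition step_char :: "nat \<Rightarrow> real \<Rightarrow> real \<Rightarrow> real" where
  "step_char N c \<theta> = 1 - c * (2 * sin (\<theta> / 2)) ^ (2 * N)"

text \<open>
  Up to the factor \<open>e\<^bsup>-iN\<theta>\<^esup>\<close>, which makes the sum symmetric, the binomial part of the weights sums
  to \<open>(1 - e\<^bsup>i\<theta>\<^esup>)\<^bsup>2N\<^esup>\<close>; and \<open>e\<^bsup>-i\<theta>/2\<^esup> (1 - e\<^bsup>i\<theta>\<^esup>) = -2i sin (\<theta>/2)\<close>.
\<close>
lemma step_characteristic_function:
  "(\<Sum>k\<in>{- int N..int N}. of_real (step_weight N c k) * exp (\<i> * of_real (\<theta> * of_int k)))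
     = of_real (step_char N c \<theta>)"
proof -
  let ?e = "exp (\<i> * of_real \<theta>)" and ?h = "exp (- (\<i> * of_real (\<theta> / 2)))"
  have "(\<Sum>k\<in>{- int N..int N}. of_real ((-1) powi (k - 1) * c * real ((2 * N) choose nat (k + int N)))
          * exp (\<i> * of_real (\<theta> * of_int k)))
      = (\<Sum>i\<le>2 * N. of_real ((-1) powi (int i - int N - 1) * c * real ((2 * N) choose i))
          * exp (\<i> * of_real (\<theta> * of_int (int i - int N))))"
    by (rule sum.reindex_bij_witness[of _ "\<lambda>i. int i - int N" "\<lambda>k. nat (k + int N)"]) auto
  also have "\<dots> = (\<Sum>i\<le>2 * N. (- ((-1) ^ N) * of_real c * ?h ^ (2 * N))
                       * (of_nat ((2 * N) choose i) * (- ?e) ^ i * 1 ^ (2 * N - i)))"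
  proof (rule sum.cong)
    fix i
    have sgn: "(-1 :: real) powi (int i - int N - 1) = - ((-1) ^ N * (-1) ^ i)"
      by (simp add: power_int_diff divide_inverse power_inverse[symmetric] ac_simps)
    have "?h ^ (2 * N) * ?e ^ i = exp (\<i> * of_real (\<theta> * of_int (int i - int N)))"
      by (simp add: exp_of_nat_mult[symmetric] exp_add[symmetric] algebra_simps)
    then show "of_real ((-1) powi (int i - int N - 1) * c * real ((2 * N) choose i))
          * exp (\<i> * of_real (\<theta> * of_int (int i - int N)))
        = (- ((-1) ^ N) * of_real c * ?h ^ (2 * N))
                       * (of_nat ((2 * N) choose i) * (- ?e) ^ i * 1 ^ (2 * N - i))"
      unfolding sgn power_minus[of ?e] by (simp add: ac_simps)
  qed simp
  also have "\<dots> = (- ((-1) ^ N) * of_real c * ?h ^ (2 * N)) * (- ?e + 1) ^ (2 * N)"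
    by (simp only: binomial_ring sum_distrib_left)
  also have "\<dots> = - ((-1) ^ N) * of_real c * (?h * (1 - ?e)) ^ (2 * N)"
    by (simp add: power_mult_distrib)
  also have "?h * (1 - ?e) = - (2 * \<i> * of_real (sin (\<theta> / 2)))"
  proof -
    have "?h * (1 - ?e) = exp (- (\<i> * of_real (\<theta> / 2))) - exp (\<i> * of_real (\<theta> / 2))"
      by (simp add: right_diff_distrib exp_add[symmetric])
    then show ?thesis
      by (simp add: sin_of_real[symmetric] sin_exp_eq)
  qed
  also have "- ((-1) ^ N) * of_real c * (- (2 * \<i> * of_real (sin (\<theta> / 2)))) ^ (2 * N)
      = of_real (- c * (2 * sin (\<theta> / 2)) ^ (2 * N))"
  proof -
    have "(- (2 * \<i> * of_real (sin (\<theta> / 2)))) ^ (2 * N)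
        = (- of_real ((2 * sin (\<theta> / 2))\<^sup>2) :: complex) ^ N"
      by (simp add: power_mult power_mult_distrib)
    also have "\<dots> = (-1) ^ N * of_real ((2 * sin (\<theta> / 2)) ^ (2 * N))"
      by (subst power_minus) (simp only: power_mult of_real_power)
    finally show ?thesis
      by simp
  qed
  finally have *: "(\<Sum>k\<in>{- int N..int N}.
      of_real ((-1) powi (k - 1) * c * real ((2 * N) choose nat (k + int N)))
          * exp (\<i> * of_real (\<theta> * of_int k))) = of_real (- c * (2 * sin (\<theta> / 2)) ^ (2 * N))" .
  have "(\<Sum>k\<in>{- int N..int N}. of_real (step_weight N c k) * exp (\<i> * of_real (\<theta> * of_int k)))
      = (\<Sum>k\<in>{- int N..int N}. (if k = 0 then 1 else 0)
          + of_real ((-1) powi (k - 1) * c * real ((2 * N) choose nat (k + int N)))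
          * exp (\<i> * of_real (\<theta> * of_int k)))"
    by (rule sum.cong) (auto simp: step_weight_def distrib_right)
  also have "\<dots> = 1 + of_real (- c * (2 * sin (\<theta> / 2)) ^ (2 * N))"
    unfolding sum.distrib * by simp
  finally show ?thesis
    by (simp add: step_char_def)
qed

lemma expectation_upto_exp_linear:
  "expectation_upto N c M (\<lambda>u. exp (\<i> * of_real (\<Sum>j=1..M. a j * of_int (u j))))
     = of_real (\<Prod>j=1..M. step_char N c (a j))"
proof -
  have "expectation_upto N c M (\<lambda>u. exp (\<i> * of_real (\<Sum>j=1..M. a j * of_int (u j))))
      = (\<Sum>u \<in> {1..M} \<rightarrow>\<^sub>E {- int N..int N}.
           \<Prod>j\<in>{1..M}. of_real (step_weight N c (u j)) * exp (\<i> * of_real (a j * of_int (u j))))"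
    by (simp add: expectation_upto_def prod.distrib exp_sum sum_distrib_left)
  also have "\<dots> = (\<Prod>j=1..M. \<Sum>k\<in>{- int N..int N}.
      of_real (step_weight N c k) * exp (\<i> * of_real (a j * of_int k)))"
    by (rule prod_sum_PiE[symmetric]) auto
  also have "\<dots> = of_real (\<Prod>j=1..M. step_char N c (a j))"
    by (simp only: step_characteristic_function of_real_prod)
  finally show ?thesis .
qed

text \<open>Exchanging the two summations collects, for each step, the coefficients of all positions
  that the step influences.\<close>
lemma sum_walk_eq_sum_steps:
  fixes a :: "nat \<Rightarrow> real"
  assumes "finite L" and "\<And>l. l \<in> L \<Longrightarrow> m l \<le> M"
  shows "(\<Sum>l\<in>L. a l * of_int (walk (m l) u)) = (\<Sum>j=1..M. (\<Sum>l | l \<in> L \<and> j \<le> m l. a l) * of_int (u j))"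
proof -
  have "(\<Sum>l\<in>L. a l * of_int (walk (m l) u)) = (\<Sum>l\<in>L. \<Sum>j=1..m l. a l * of_int (u j))"
    by (simp add: walk_def sum_distrib_left)
  also have "\<dots> = (\<Sum>l\<in>L. \<Sum>j | j \<in> {1..M} \<and> j \<le> m l. a l * of_int (u j))"
    using assms(2) by (intro sum.cong refl) fastforce+
  also have "\<dots> = (\<Sum>j=1..M. \<Sum>l | l \<in> L \<and> j \<le> m l. a l * of_int (u j))"
    by (rule sum.swap_restrict) (use assms(1) in auto)
  finally show ?thesis
    by (simp add: sum_distrib_right)
qed

lemma prod_consecutive_blocks:
  fixes m :: "nat \<Rightarrow> nat" and f :: "nat \<Rightarrow> 'a::comm_monoid_mult"
  assumes "\<And>k l. k \<le> l \<Longrightarrow> l \<le> r \<Longrightarrow> m k \<le> m l"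
  shows "prod f {m 0<..m r} = (\<Prod>l=1..r. prod f {m (l - 1)<..m l})"
  using assms
proof (induction r)
  case (Suc r)
  have "{m 0<..m (Suc r)} = {m 0<..m r} \<union> {m r<..m (Suc r)}"
    using Suc.prems[of 0 r] Suc.prems[of r "Suc r"] by auto
  then show ?case
    using Suc by (simp add: prod.union_disjoint)
qed simp

text \<open>
  All steps of the block \<open>{m (l - 1)<..m l}\<close> carry the same coefficient, because by monotonicity
  the positions beyond such a step are exactly those numbered \<open>l, \<dots>, r\<close>.
\<close>
lemma walk_expectation_blocks:
  fixes m :: "nat \<Rightarrow> nat" and a :: "nat \<Rightarrow> real"
  assumes "N \<ge> 1" and "m 0 = 0" and mono: "\<And>k l. k \<le> l \<Longrightarrow> l \<le> r \<Longrightarrow> m k \<le> m l"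
  shows "walk_expectation N c (\<lambda>u. exp (\<i> * of_real (\<Sum>l=1..r. a l * of_int (walk (m l) u))))
     = of_real (\<Prod>l=1..r. step_char N c (\<Sum>k=l..r. a k) ^ (m l - m (l - 1)))"
proof -
  let ?b = "\<lambda>j. \<Sum>l | l \<in> {1..r} \<and> j \<le> m l. a l"
  have eq: "(\<Sum>l=1..r. a l * of_int (walk (m l) u)) = (\<Sum>j=1..m r. ?b j * of_int (u j))" for u
    by (rule sum_walk_eq_sum_steps) (use mono in auto)
  have "depends_on_first (m r) (\<lambda>u. exp (\<i> * of_real (\<Sum>j=1..m r. ?b j * of_int (u j))))"
    unfolding depends_on_first_def by (auto intro!: sum.cong)
  then have "walk_expectation N c (\<lambda>u. exp (\<i> * of_real (\<Sum>l=1..r. a l * of_int (walk (m l) u))))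
      = of_real (\<Prod>j=1..m r. step_char N c (?b j))"
    unfolding eq by (subst walk_expectation_eq[OF assms(1)]) (auto simp only: expectation_upto_exp_linear)
  also have "{1..m r} = {m 0<..m r}"
    using assms(2) by auto
  also have "(\<Prod>j\<in>\<dots>. step_char N c (?b j))
      = (\<Prod>l=1..r. \<Prod>j\<in>{m (l - 1)<..m l}. step_char N c (?b j))"
    by (rule prod_consecutive_blocks) (use mono in auto)
  also have "\<dots> = (\<Prod>l=1..r. step_char N c (\<Sum>k=l..r. a k) ^ (m l - m (l - 1)))"
  proof (rule prod.cong)
    fix l assume l: "l \<in> {1..r}"
    have "?b j = (\<Sum>k=l..r. a k)" if j: "j \<in> {m (l - 1)<..m l}" for j
    proof (rule sum.cong)
      have "j \<le> m k \<longleftrightarrow> l \<le> k" if "k \<le> r" for k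
      proof (cases "l \<le> k")
        case True
        then show ?thesis using mono[of l k] j that by auto
      next
        case False
        then have "m k \<le> m (l - 1)" using l by (intro mono) auto
        then show ?thesis using False j by auto
      qed
      then show "{k. k \<in> {1..r} \<and> j \<le> m k} = {l..r}"
        using l by auto
    qed simp
    then show "(\<Prod>j\<in>{m (l - 1)<..m l}. step_char N c (?b j))
        = step_char N c (\<Sum>k=l..r. a k) ^ (m l - m (l - 1))"
      by simp
  qed simp
  finally show ?thesis .
qed

definition step_count :: "nat \<Rightarrow> real \<Rightarrow> real \<Rightarrow> nat" where
  "step_count N \<epsilon> t = nat \<lfloor>t / \<epsilon> ^ (2 * N)\<rfloor>"

lemma step_count_mono: "\<epsilon> > 0 \<Longrightarrow> s \<le> t \<Longrightarrow> step_count N \<epsilon> s \<le> step_count N \<epsilon> t"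
  unfolding step_count_def by (intro nat_mono floor_mono divide_right_mono) auto

lemma walk_expectation_ordered:
  fixes s \<nu> :: "nat \<Rightarrow> real"
  assumes "N \<ge> 1" and "\<epsilon> > 0" and "s 0 = 0" and mono: "\<And>k l. k \<le> l \<Longrightarrow> l \<le> r \<Longrightarrow> s k \<le> s l"
  shows "walk_expectation N c (\<lambda>u. exp (\<i> * of_real (\<Sum>l=1..r. \<nu> l * scaled_walk N \<epsilon> (s l) u)))
     = of_real (\<Prod>l=1..r. step_char N c (\<epsilon> * (\<Sum>k=l..r. \<nu> k))
                   ^ (step_count N \<epsilon> (s l) - step_count N \<epsilon> (s (l - 1))))"
proof -
  have "(\<Sum>l=1..r. \<nu> l * scaled_walk N \<epsilon> (s l) u)
      = (\<Sum>l=1..r. (\<epsilon> * \<nu> l) * of_int (walk (step_count N \<epsilon> (s l)) u))" for u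
    by (simp add: scaled_walk_def step_count_def ac_simps)
  moreover have "step_count N \<epsilon> (s 0) = 0"
    by (simp add: step_count_def assms(3))
  ultimately show ?thesis
    unfolding sum_distrib_left
    by (simp only:) (rule walk_expectation_blocks, use assms step_count_mono in auto)
qed

section \<open>The scaling limit\<close>

text \<open>
  With \<open>ln (1 + x) = x + O(x\<^sup>2)\<close>, the logarithm \<open>m ln (1 + x)\<close> differs from \<open>m x\<close> by
  \<open>O(\<bar>m x\<bar> \<bar>x\<bar>)\<close>, which vanishes in the limit. This way \<open>x\<close> may be \<open>0\<close>.
\<close>
lemma one_plus_power_tendsto_exp:
  fixes x :: "'a \<Rightarrow> real" and m :: "'a \<Rightarrow> nat"
  assumes x: "(x \<longlongrightarrow> 0) F" and mx: "((\<lambda>e. real (m e) * x e) \<longlongrightarrow> y) F"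
  shows "((\<lambda>e. (1 + x e) ^ m e) \<longlongrightarrow> exp y) F"
proof -
  have small: "\<forall>\<^sub>F e in F. \<bar>x e\<bar> < 1 / 2"
    using tendstoD[OF x, of "1 / 2"] by simp
  have "((\<lambda>e. 2 * \<bar>real (m e) * x e\<bar> * \<bar>x e\<bar>) \<longlongrightarrow> 2 * \<bar>y\<bar> * \<bar>0\<bar>) F"
    by (intro tendsto_intros x mx)
  then have bound: "((\<lambda>e. 2 * \<bar>real (m e) * x e\<bar> * \<bar>x e\<bar>) \<longlongrightarrow> 0) F"
    by simp
  have "\<forall>\<^sub>F e in F. norm (real (m e) * (ln (1 + x e) - x e)) \<le> 2 * \<bar>real (m e) * x e\<bar> * \<bar>x e\<bar>"
    using small
  proof eventually_elim
    case (elim e)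
    have "real (m e) * \<bar>ln (1 + x e) - x e\<bar> \<le> real (m e) * (2 * (x e)\<^sup>2)"
      using abs_ln_one_plus_x_minus_x_bound[of "x e"] elim by (intro mult_left_mono) auto
    then show ?case
      by (simp add: abs_mult power2_eq_square ac_simps)
  qed
  from this bound have "((\<lambda>e. real (m e) * (ln (1 + x e) - x e)) \<longlongrightarrow> 0) F"
    by (rule Lim_null_comparison)
  from tendsto_add[OF mx this] have "((\<lambda>e. exp (real (m e) * ln (1 + x e))) \<longlongrightarrow> exp y) F"
    by (intro tendsto_exp) (simp add: algebra_simps)
  moreover have "\<forall>\<^sub>F e in F. exp (real (m e) * ln (1 + x e)) = (1 + x e) ^ m e"
    using small by eventually_elim (simp add: exp_of_nat_mult)
  ultimately show ?thesis
    by (rule Lim_transform_eventually)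
qed

lemma step_count_tendsto:
  assumes "N \<ge> 1" and "t \<ge> 0"
  shows "((\<lambda>\<epsilon>. real (step_count N \<epsilon> t) * \<epsilon> ^ (2 * N)) \<longlongrightarrow> t) (at_right 0)"
proof (rule tendsto_sandwich)
  have pos: "\<forall>\<^sub>F \<epsilon> :: real in at_right 0. \<epsilon> > 0"
    by (simp add: eventually_at_right_less)
  have bounds: "t - \<epsilon> ^ (2 * N) \<le> real (step_count N \<epsilon> t) * \<epsilon> ^ (2 * N)"
    "real (step_count N \<epsilon> t) * \<epsilon> ^ (2 * N) \<le> t" if "\<epsilon> > 0" for \<epsilon>
  proof -
    have p: "\<epsilon> ^ (2 * N) > 0" using that by simp
    have f: "real (step_count N \<epsilon> t) = of_int \<lfloor>t / \<epsilon> ^ (2 * N)\<rfloor>"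
      using p assms(2) by (simp add: step_count_def)
    have "t / \<epsilon> ^ (2 * N) - 1 \<le> real (step_count N \<epsilon> t)" "real (step_count N \<epsilon> t) \<le> t / \<epsilon> ^ (2 * N)"
      unfolding f by linarith+
    then show "t - \<epsilon> ^ (2 * N) \<le> real (step_count N \<epsilon> t) * \<epsilon> ^ (2 * N)"
      "real (step_count N \<epsilon> t) * \<epsilon> ^ (2 * N) \<le> t"
      using p by (simp_all add: field_simps)
  qed
  show "\<forall>\<^sub>F \<epsilon> in at_right 0. t - \<epsilon> ^ (2 * N) \<le> real (step_count N \<epsilon> t) * \<epsilon> ^ (2 * N)"
    using pos by eventually_elim (rule bounds)
  show "\<forall>\<^sub>F \<epsilon> in at_right 0. real (step_count N \<epsilon> t) * \<epsilon> ^ (2 * N) \<le> t"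
    using pos by eventually_elim (rule bounds)
  have "((\<lambda>\<epsilon>. t - \<epsilon> ^ (2 * N)) \<longlongrightarrow> t - 0 ^ (2 * N)) (at_right (0::real))"
    by (intro tendsto_intros)
  then show "((\<lambda>\<epsilon>. t - \<epsilon> ^ (2 * N)) \<longlongrightarrow> t) (at_right 0)"
    using assms(1) by (simp add: zero_power)
qed simp

lemma step_char_asymptotics:
  "((\<lambda>\<epsilon>. (step_char N c (\<epsilon> * b) - 1) / \<epsilon> ^ (2 * N)) \<longlongrightarrow> - c * b ^ (2 * N)) (at_right 0)"
proof -
  have "((\<lambda>\<epsilon>. sin (\<epsilon> * b / 2)) has_real_derivative b / 2) (at 0)"
    by (auto intro!: derivative_eq_intros)
  then have "((\<lambda>\<epsilon>. sin (\<epsilon> * b / 2) / \<epsilon>) \<longlongrightarrow> b / 2) (at 0)"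
    by (simp add: DERIV_def)
  then have "((\<lambda>\<epsilon>. sin (\<epsilon> * b / 2) / \<epsilon>) \<longlongrightarrow> b / 2) (at_right 0)"
    by (rule filterlim_mono) (simp_all add: at_within_le_at)
  then have "((\<lambda>\<epsilon>. - c * (2 * (sin (\<epsilon> * b / 2) / \<epsilon>)) ^ (2 * N)) \<longlongrightarrow> - c * (2 * (b / 2)) ^ (2 * N)) (at_right 0)"
    by (intro tendsto_mult tendsto_power tendsto_const)
  then show ?thesis
    by (simp add: step_char_def power_divide)
qed

lemma block_power_tendsto:
  assumes "N \<ge> 1" and "0 \<le> s" and "s \<le> t"
  shows "((\<lambda>\<epsilon>. step_char N c (\<epsilon> * b) ^ (step_count N \<epsilon> t - step_count N \<epsilon> s))
            \<longlongrightarrow> exp (- c * b ^ (2 * N) * (t - s))) (at_right 0)"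
proof -
  let ?x = "\<lambda>\<epsilon>. step_char N c (\<epsilon> * b) - 1"
  let ?m = "\<lambda>\<epsilon>. step_count N \<epsilon> t - step_count N \<epsilon> s"
  have pos: "\<forall>\<^sub>F \<epsilon> :: real in at_right 0. \<epsilon> > 0"
    by (simp add: eventually_at_right_less)
  have "((\<lambda>\<epsilon>. (step_char N c (\<epsilon> * b) - 1) / \<epsilon> ^ (2 * N) * \<epsilon> ^ (2 * N))
          \<longlongrightarrow> - c * b ^ (2 * N) * 0 ^ (2 * N)) (at_right 0)"
    by (intro tendsto_intros step_char_asymptotics)
  then have "((\<lambda>\<epsilon>. (step_char N c (\<epsilon> * b) - 1) / \<epsilon> ^ (2 * N) * \<epsilon> ^ (2 * N)) \<longlongrightarrow> 0) (at_right 0)"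
    using assms(1) by (simp add: zero_power)
  moreover have "\<forall>\<^sub>F \<epsilon> in at_right 0. (step_char N c (\<epsilon> * b) - 1) / \<epsilon> ^ (2 * N) * \<epsilon> ^ (2 * N) = ?x \<epsilon>"
    using pos by eventually_elim simp
  ultimately have x: "(?x \<longlongrightarrow> 0) (at_right 0)"
    by (rule Lim_transform_eventually)
  have "((\<lambda>\<epsilon>. (step_char N c (\<epsilon> * b) - 1) / \<epsilon> ^ (2 * N) *
            (real (step_count N \<epsilon> t) * \<epsilon> ^ (2 * N) - real (step_count N \<epsilon> s) * \<epsilon> ^ (2 * N)))
          \<longlongrightarrow> - c * b ^ (2 * N) * (t - s)) (at_right 0)"
    using assms by (intro tendsto_intros step_char_asymptotics step_count_tendsto) auto
  moreover have "\<forall>\<^sub>F \<epsilon> in at_right 0. (step_char N c (\<epsilon> * b) - 1) / \<epsilon> ^ (2 * N) *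
            (real (step_count N \<epsilon> t) * \<epsilon> ^ (2 * N) - real (step_count N \<epsilon> s) * \<epsilon> ^ (2 * N))
          = real (?m \<epsilon>) * ?x \<epsilon>"
    using pos
  proof eventually_elim
    case (elim \<epsilon>)
    then show ?case
      using step_count_mono[OF elim assms(3), of N] by (simp add: of_nat_diff field_simps)
  qed
  ultimately have "((\<lambda>\<epsilon>. real (?m \<epsilon>) * ?x \<epsilon>) \<longlongrightarrow> - c * b ^ (2 * N) * (t - s)) (at_right 0)"
    by (rule Lim_transform_eventually)
  from one_plus_power_tendsto_exp[OF x this] show ?thesis
    by simp
qed

section \<open>Reduction to ordered times\<close>

text \<open>The value \<open>s 0 = 0\<close> is the fixed starting time \<open>t\<^sub>0\<close>; it may coincide with \<open>s 1\<close>.\<close>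
lemma ordered_times:
  fixes T :: "real set"
  assumes "finite T" and "T \<noteq> {}" and "T \<subseteq> {0..}"
  obtains r s where "r \<ge> 1" and "s 0 = 0" and "s ` {1..r} = T" and "inj_on s {1..r}"
    and "\<And>k. k \<in> {1..<r} \<Longrightarrow> s k < s (Suc k)"
    and "\<And>k l. k \<le> l \<Longrightarrow> l \<le> r \<Longrightarrow> s k \<le> s l"
proof -
  define xs where "xs = sorted_list_of_set T"
  define s where "s k = (if k = 0 then 0 else xs ! (k - 1))" for k
  have xs: "set xs = T" "sorted xs" "distinct xs" "length xs = card T"
    using assms(1) by (auto simp: xs_def)
  have strict: "s k < s l" if "1 \<le> k" "k < l" "l \<le> card T" for k l
    using sorted_wrt_nth_less[of "(<)" xs "k - 1" "l - 1"] xs that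
    by (auto simp: s_def strict_sorted_iff)
  have img: "s ` {1..card T} = T"
  proof -
    have "s ` {1..card T} = (\<lambda>i. s (Suc i)) ` {..<card T}"
      by (simp only: image_Suc_lessThan[symmetric] image_image)
    also have "\<dots> = (!) xs ` {..<length xs}"
      by (simp add: s_def xs)
    also have "\<dots> = T"
      using xs(1) by (auto simp: set_conv_nth)
    finally show ?thesis .
  qed
  show thesis
  proof (rule that)
    show "1 \<le> card T" using assms by (simp add: Suc_le_eq card_gt_0_iff)
    show "inj_on s {1..card T}"
      by (rule eq_card_imp_inj_on) (use img in simp_all)
    show "s k \<le> s l" if "k \<le> l" "l \<le> card T" for k l
    proof (cases "k = 0")
      case True
      then show ?thesis
        using img assms(3) that by (cases "l = 0") (auto simp: s_def[of 0])
    next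
      case False
      then show ?thesis
        using strict[of k l] that by (cases "k = l") auto
    qed
  qed (use img strict in \<open>auto simp: s_def[of 0]\<close>)
qed

text \<open>For \<open>s\<close> enumerating the distinct values of \<open>t\<close>, the fibres of \<open>t\<close> partition the index set.\<close>
lemma sum_group_times:
  fixes \<mu> :: "nat \<Rightarrow> real" and f :: "real \<Rightarrow> real"
  assumes "finite K" and "s ` L = t ` K" and "inj_on s L"
  shows "(\<Sum>k\<in>K. \<mu> k * f (t k)) = (\<Sum>l\<in>L. (\<Sum>k | k \<in> K \<and> t k = s l. \<mu> k) * f (s l))"
proof -
  have "(\<Sum>k\<in>K. \<mu> k * f (t k)) = (\<Sum>y\<in>t ` K. \<Sum>k | k \<in> K \<and> t k = y. \<mu> k * f (t k))"
    by (rule sum.image_gen) (rule assms)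
  also have "\<dots> = (\<Sum>y\<in>s ` L. (\<Sum>k | k \<in> K \<and> t k = y. \<mu> k) * f y)"
    by (simp add: assms(2) sum_distrib_right)
  also have "\<dots> = (\<Sum>l\<in>L. (\<Sum>k | k \<in> K \<and> t k = s l. \<mu> k) * f (s l))"
    by (simp add: sum.reindex[OF assms(3)])
  finally show ?thesis .
qed

section \<open>Convergence of the scaled walk\<close>

theorem theorem4p2:
  fixes N n :: nat and c :: real and t \<mu> :: "nat \<Rightarrow> real"
    and X :: "real set \<Rightarrow> (real \<Rightarrow> real) signed_measure"
  assumes "N \<ge> 1" and "0 < c" and "c \<le> 1 / 2 ^ (2 * N - 1)"
    and "pseudo_brownian_motion N c X"
    and "n \<ge> 1" and "\<And>k. k \<in> {1..n} \<Longrightarrow> 0 \<le> t k"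
  shows "((\<lambda>\<epsilon>. walk_expectation N c
              (\<lambda>u. exp (\<i> * of_real (\<Sum>k=1..n. \<mu> k * scaled_walk N \<epsilon> (t k) u))))
          \<longlongrightarrow> signed_integral (X (t ` {1..n}))
              (\<lambda>x. exp (\<i> * of_real (\<Sum>k=1..n. \<mu> k * x (t k))))) (at_right 0)"
proof -
  obtain r s where r: "r \<ge> 1" and s0: "s 0 = 0" and img: "s ` {1..r} = t ` {1..n}"
    and inj: "inj_on s {1..r}" and strict: "\<And>k. k \<in> {1..<r} \<Longrightarrow> s k < s (Suc k)"
    and mono: "\<And>k l. k \<le> l \<Longrightarrow> l \<le> r \<Longrightarrow> s k \<le> s l"
    by (rule ordered_times[of "t ` {1..n}"]) (use assms(5,6) in auto)
  define \<nu> where "\<nu> l = (\<Sum>k | k \<in> {1..n} \<and> t k = s l. \<mu> k)" for l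
  \<comment> \<open>Needed both for \<open>f = (\<lambda>y. scaled_walk N \<epsilon> y u)\<close> and for points \<open>f = x\<close> of the product space.\<close>
  have regroup: "(\<Sum>k=1..n. \<mu> k * f (t k)) = (\<Sum>l=1..r. \<nu> l * f (s l))" for f
    unfolding \<nu>_def by (rule sum_group_times[OF _ img inj]) simp
  have "signed_integral (X (t ` {1..n})) (\<lambda>x. exp (\<i> * of_real (\<Sum>k=1..n. \<mu> k * x (t k))))
      = signed_integral (X (s ` {1..r})) (\<lambda>x. exp (\<i> * of_real (\<Sum>l=1..r. \<nu> l * x (s l))))"
    by (simp only: img regroup)
  also have "\<dots> = of_real (exp (- c * (\<Sum>l=1..r. (\<Sum>k=l..r. \<nu> k) ^ (2 * N) * (s l - s (l - 1)))))"
    using assms(4) r s0 strict mono[of 0 1] unfolding pseudo_brownian_motion_def by auto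
  also have "\<dots> = of_real (\<Prod>l=1..r. exp (- c * (\<Sum>k=l..r. \<nu> k) ^ (2 * N) * (s l - s (l - 1))))"
    by (simp add: exp_sum[symmetric] sum_distrib_left ac_simps sum_negf)
  finally have limit: "signed_integral (X (t ` {1..n}))
      (\<lambda>x. exp (\<i> * of_real (\<Sum>k=1..n. \<mu> k * x (t k)))) = \<dots>" .
  have "((\<lambda>\<epsilon>. complex_of_real (\<Prod>l=1..r. step_char N c (\<epsilon> * (\<Sum>k=l..r. \<nu> k))
                 ^ (step_count N \<epsilon> (s l) - step_count N \<epsilon> (s (l - 1)))))
      \<longlongrightarrow> of_real (\<Prod>l=1..r. exp (- c * (\<Sum>k=l..r. \<nu> k) ^ (2 * N) * (s l - s (l - 1))))) (at_right 0)"
    using mono[of 0] mono s0 by (intro tendsto_of_real tendsto_prod block_power_tendsto assms(1)) auto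
  moreover have "\<forall>\<^sub>F \<epsilon> in at_right 0.
      complex_of_real (\<Prod>l=1..r. step_char N c (\<epsilon> * (\<Sum>k=l..r. \<nu> k))
                 ^ (step_count N \<epsilon> (s l) - step_count N \<epsilon> (s (l - 1))))
      = walk_expectation N c (\<lambda>u. exp (\<i> * of_real (\<Sum>k=1..n. \<mu> k * scaled_walk N \<epsilon> (t k) u)))"
    using eventually_at_right_less[of "0 :: real"]
  proof eventually_elim
    case (elim \<epsilon>)
    show ?case
      unfolding regroup[of "\<lambda>y. scaled_walk N \<epsilon> y _"]
      by (rule walk_expectation_ordered[symmetric]) (use assms(1) elim s0 mono in auto)
  qed
  ultimately show ?thesis
    unfolding limit by (rule Lim_transform_eventually)
qed

end
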